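(* No two-sided frieze type whose label is of the form $\mathrm{pm}{\ast}\mathrm{a}$ (symbol $\mathrm m$ in the second position and symbol $\mathrm a$ in the fourth position) can be realised in hitomezashi. That is, none of the types $\mathrm{pmma}$, $\mathrm{pmaa}$, $\mathrm{pm2a}$ is the type of any hitomezashi two-sided frieze.
   Context: **Hitomezashi two-sided friezes.** Let $x=(x_i)_{i\in\mathbb Z}$ be a periodic bi-infinite binary sequence (given by indefinite repetition of a finite binary word), and let $y=y_1\cdots y_n$ be a finite binary word with $n=|y|\ge 2$. The grid edges of the strip are the vertical unit edges from $(i,j)$ to $(i,j+1)$ for $i\in\mathbb Z$, $1\le j\le n-1$, and the horizontal unit edges from $(i,j)$ to $(i+1,j)$ for $i\in\mathbb Z$, $1\le j\le n$. Stitches and gaps alternate along each line. On the front, the vertical edge from $(i,j)$ to $(i,j+1)$ carries a stitch iff ($x_i=1$ and $j$ odd) or ($x_i=0$ and $j$ even); the horizontal edge from $(i,j)$ to $(i+1,j)$ carries a stitch iff ($y_j=1$ and $i$ even) or ($y_j=0$ and $i$ odd). Let $F$ be the set of edges carrying a stitch on the front. On the back, a stitch lies behind each gap of the front and a gap behind each stitch, so the set $B$ of edges stitched on the back (in the same planar coordinates) is the complement of $F$ in the set of all grid edges. The pair $(F,B)$ is the hitomezashi two-sided frieze given by $x,y$. **Symmetries.** Axis $\mathbf a$ is the horizontal central line of the strip in the frieze plane, $\mathbf b$ is perpendicular to $\mathbf a$ in the frieze plane, and $\mathbf c$ is perpendicular to the frieze plane. A candidate isometry is a quadruple $(s,t,e,d)$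 with $s,e,d\in\{+1,-1\}$, $t\in\mathbb R$. It acts on the plane by $X\mapsto sX+t$ on the horizontal coordinate, fixes the vertical coordinate if $e=+1$, sends it to $Y\mapsto n+1-Y$ if $e=-1$, and keeps the two sides if $d=+1$ or exchanges them if $d=-1$. It is a symmetry of $(F,B)$ if its planar action maps $F$ to $F$ and $B$ to $B$ (case $d=+1$), or $F$ to $B$ and $B$ to $F$ (case $d=-1$). The symmetries form a group $G$, whose pure translations $(+1,t,+1,+1)$ are those with $t\in T\mathbb Z$ for some $T>0$. **Labels.** A two-sided frieze type has a label $\mathrm{p}\ast\ast\ast$ whose second, third and fourth positions describe symmetry relative to $\mathbf a$, $\mathbf b$, $\mathbf c$ respectively. Symbols: $1$ is a placeholder; $\mathrm m$ is reflection in a plane perpendicular to the axis; $\mathrm a$ is glide reflection, the reflection being in a plane perpendicular to the axis and the glide parallel to $\mathbf a$; $2$ is rotation by $180^\circ$ about the axis (for $\mathbf b$, $\mathbf c$: about some line parallel to it meeting $\mathbf a$); $2'$ (second position only) is a screw, i.e. $180^\circ$ rotation about $\mathbf a$ together with a translation parallel to $\mathbf a$; $\tilde 2$ (fourth position only) is roto-reflection, i.e. $180^\circ$ rotation about a line parallel to $\mathbf c$ together with reflection in the frieze plane. Two symbols applying to the same axis are stacked. In terms of quadruples, the symbols in the various positions are: second position: $\mathrm m=(-1,t,+,+)$, $2=(+1,0,-,-)$, $2'=(+1,T/2,-,-)$; third position: $\mathrm m=(+1,0,-,+)$, $\mathrm a=(+1,T/2,-,+)$, $2=(-1,t,+,-)$;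 fourth position: $\mathrm m=(+1,0,+,-)$, $\mathrm a=(+1,T/2,+,-)$, $2=(-1,t,-,+)$, $\tilde 2=(-1,t,-,-)$ (with $t$ some real number). A frieze is of the type with a given label if $G$ is generated by its translations and symmetries of the kinds shown by the symbols in the label. If several symbols with $s=-1$ appear, they arise from one another by composition with elements with $s=+1$, so only one of them together with the symbols with $s=+1$ need be taken as generators. The 31 types are: $\mathrm{p111}$, $\mathrm{pm11}$, $\mathrm{p112}$, $\mathrm{p121}$, $\mathrm{p}11\tilde2$, $\mathrm{p1m1}$, $\mathrm{pmm2}$, $\mathrm{p}1\stackrel{2}{\mathrm m}1$, $\mathrm{p1a1}$, $\mathrm{pma2}$, $\mathrm{p}1\stackrel{2}{\mathrm a}1$, $\mathrm{p11m}$, $\mathrm{pm2m}$, $\mathrm{p}11\stackrel{2}{\mathrm m}$, $\mathrm{p11a}$, $\mathrm{pm2a}$, $\mathrm{p}11\stackrel{2}{\mathrm a}$, $\mathrm{p211}$, $\mathrm{p}\stackrel{2}{\mathrm m}11$, $\mathrm{p222}$, $\mathrm{p}2'11$, $\mathrm{p}\stackrel{2'}{\mathrm m}11$, $\mathrm{p}2'22$, $\mathrm{p2mm}$, $\mathrm{pmmm}$, $\mathrm{p}2'\mathrm{am}$, $\mathrm{pmam}$, $\mathrm{p}2'\mathrm{ma}$, $\mathrm{pmma}$, $\mathrm{p2aa}$, $\mathrm{pmaa}$ (in $\mathrm{pmmm}$, $\mathrm{pmam}$, $\mathrm{pmma}$, $\mathrm{pmaa}$ the three displayed symbols generate, with the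 translations, the whole group). A type is realised in hitomezashi if some hitomezashi two-sided frieze is of that type. *)

theory Defs
  imports Complex_Main "HOL-Algebra.Generated_Groups"
begin

section \<open>Hitomezashi two-sided friezes\<close>

text \<open>
  A unit grid edge is represented by the set of its two end points. The binary digits 1 and 0 are
  \<^const>\<open>True\<close> and \<^const>\<open>False\<close>; the letter \<open>y\<^sub>j\<close> (with \<open>1 \<le> j\<close>) of a word is \<open>y ! (j - 1)\<close>.
\<close>

type_synonym point = "real \<times> real"
type_synonym edge = "point set"

definition vedge :: "int \<Rightarrow> nat \<Rightarrow> edge" where
  "vedge i j = {(of_int i, of_nat j), (of_int i, of_nat (j + 1))}"

definition hedge :: "int \<Rightarrow> nat \<Rightarrow> edge" where
  "hedge i j = {(of_int i, of_nat j), (of_int (i + 1), of_nat j)}"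

definition grid_edges :: "nat \<Rightarrow> edge set" where
  "grid_edges n =
     {vedge i j |i j. 1 \<le> j \<and> j \<le> n - 1} \<union> {hedge i j |i j. 1 \<le> j \<and> j \<le> n}"

definition front_stitches :: "(int \<Rightarrow> bool) \<Rightarrow> bool list \<Rightarrow> edge set" where
  "front_stitches x y =
     {vedge i j |i j. 1 \<le> j \<and> j \<le> length y - 1 \<and> (x i \<and> odd j \<or> \<not> x i \<and> even j)} \<union>
     {hedge i j |i j. 1 \<le> j \<and> j \<le> length y \<and> (y ! (j - 1) \<and> even i \<or> \<not> y ! (j - 1) \<and> odd i)}"

definition back_stitches :: "(int \<Rightarrow> bool) \<Rightarrow> bool list \<Rightarrow> edge set" where
  "back_stitches x y = grid_edges (length y) - front_stitches x y"

definition periodic_seq :: "(int \<Rightarrow> 'a) \<Rightarrow> bool" where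
  "periodic_seq x \<longleftrightarrow> (\<exists>p>0. \<forall>i. x (i + p) = x i)"


section \<open>Symmetries\<close>

text \<open>The quadruple \<open>(s, t, e, d)\<close>, with \<open>s\<close>, \<open>e\<close>, \<open>d\<close> equal to 1 or -1.\<close>

type_synonym isometry = "int \<times> real \<times> int \<times> int"

fun planar_action :: "nat \<Rightarrow> isometry \<Rightarrow> point \<Rightarrow> point" where
  "planar_action n (s, t, e, d) (X, Y) =
     (of_int s * X + t, if e = 1 then Y else of_nat n + 1 - Y)"

text \<open>
  The product is composition, the right factor acting first; by \<open>planar_action_mult\<close> below it
  does not depend on the width \<open>n\<close> of the strip.
\<close>

definition isometry_group :: "isometry monoid" where
  "isometry_group =
     \<lparr> carrier = {1, -1} \<times> UNIV \<times> {1, -1} \<times> {1, -1},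
       monoid.mult = (\<lambda>(s, t, e, d) (s', t', e', d'). (s * s', of_int s * t' + t, e * e', d * d')),
       one = (1, 0, 1, 1) \<rparr>"

definition edge_action :: "nat \<Rightarrow> isometry \<Rightarrow> edge set \<Rightarrow> edge set" where
  "edge_action n g E = (\<lambda>a. planar_action n g ` a) ` E"

fun exchanges_sides :: "isometry \<Rightarrow> bool" where
  "exchanges_sides (s, t, e, d) \<longleftrightarrow> d = -1"

definition symmetries :: "(int \<Rightarrow> bool) \<Rightarrow> bool list \<Rightarrow> isometry set" where
  "symmetries x y =
     {g \<in> carrier isometry_group.
        if exchanges_sides g
        then edge_action (length y) g (front_stitches x y) = back_stitches x y \<and>
             edge_action (length y) g (back_stitches x y) = front_stitches x y
        else edge_action (length y) g (front_stitches x y) = front_stitches x y \<and>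
             edge_action (length y) g (back_stitches x y) = back_stitches x y}"

lemma mem_carrier_isometry_group:
  "(s, t, e, d) \<in> carrier isometry_group \<longleftrightarrow>
     (s = 1 \<or> s = -1) \<and> (e = 1 \<or> e = -1) \<and> (d = 1 \<or> d = -1)"
  unfolding isometry_group_def partial_object.simps mem_Times_iff fst_conv snd_conv insert_iff
  by blast

lemma planar_action_mult:
  assumes "g \<in> carrier isometry_group" "h \<in> carrier isometry_group"
  shows "planar_action n (g \<otimes>\<^bsub>isometry_group\<^esub> h) p = planar_action n g (planar_action n h p)"
proof -
  obtain s t e d s' t' e' d' X Y
    where eqs: "g = (s, t, e, d)" "h = (s', t', e', d')" "p = (X, Y)"
    by (metis prod_cases4 surj_pair)
  have "e = 1 \<or> e = -1" "e' = 1 \<or> e' = -1"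
    using assms unfolding eqs mem_carrier_isometry_group by blast+
  then show ?thesis
    by (elim disjE) (simp_all add: eqs isometry_group_def distrib_left mult.assoc)
qed

lemma group_isometry_group: "group isometry_group"
proof (rule groupI)
  fix g h assume "g \<in> carrier isometry_group" "h \<in> carrier isometry_group"
  then show "g \<otimes>\<^bsub>isometry_group\<^esub> h \<in> carrier isometry_group"
    by (cases g; cases h; simp only: mem_carrier_isometry_group; elim conjE disjE)
      (simp_all add: isometry_group_def)
next
  show "\<one>\<^bsub>isometry_group\<^esub> \<in> carrier isometry_group"
    by (simp add: isometry_group_def)
next
  fix g h k
  show "g \<otimes>\<^bsub>isometry_group\<^esub> h \<otimes>\<^bsub>isometry_group\<^esub> k = g \<otimes>\<^bsub>isometry_group\<^esub> (h \<otimes>\<^bsub>isometry_group\<^esub> k)"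
    by (cases g; cases h; cases k) (simp add: isometry_group_def distrib_left mult.assoc)
next
  fix g
  show "\<one>\<^bsub>isometry_group\<^esub> \<otimes>\<^bsub>isometry_group\<^esub> g = g"
    by (cases g) (simp add: isometry_group_def)
next
  fix g assume "g \<in> carrier isometry_group"
  then obtain s t e d where g: "g = (s, t, e, d)" "s = 1 \<or> s = -1" "e = 1 \<or> e = -1" "d = 1 \<or> d = -1"
    by (metis mem_carrier_isometry_group prod_cases4)
  have "(s, - (of_int s * t), e, d) \<otimes>\<^bsub>isometry_group\<^esub> g = \<one>\<^bsub>isometry_group\<^esub>"
    using g(2-4) unfolding g(1) by (elim disjE) (simp_all add: isometry_group_def)
  moreover have "(s, - (of_int s * t), e, d) \<in> carrier isometry_group"
    using g(2-4) by (simp add: mem_carrier_isometry_group)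
  ultimately show "\<exists>h\<in>carrier isometry_group. h \<otimes>\<^bsub>isometry_group\<^esub> g = \<one>\<^bsub>isometry_group\<^esub>"
    by blast
qed


section \<open>Frieze types\<close>

datatype axis = Axis_a | Axis_b | Axis_c

text \<open>The symbols m, a, 2, 2' and 2 with a tilde, in this order.\<close>

datatype symbol = Mirror | Glide | Rot | Screw | Rotoreflection

text \<open>
  The label \<open>P A B C\<close> carries the symbols \<open>A\<close>, \<open>B\<close>, \<open>C\<close> in its second, third and fourth position:
  the placeholder 1 is the empty set, and stacked symbols form a two-element set.
\<close>

datatype label = P "symbol set" "symbol set" "symbol set"

fun symbols_at :: "label \<Rightarrow> axis \<Rightarrow> symbol set" where
  "symbols_at (P A B C) Axis_a = A"
| "symbols_at (P A B C) Axis_b = B"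
| "symbols_at (P A B C) Axis_c = C"

text \<open>
  Isometries of the kind shown by a symbol, for a frieze whose translations form \<open>T\<int>\<close>;
  combinations of axis and symbol that occur in no label get the empty set.
\<close>

fun kind :: "real \<Rightarrow> axis \<Rightarrow> symbol \<Rightarrow> isometry set" where
  "kind T Axis_a Mirror = {(-1, t, 1, 1) |t. True}"
| "kind T Axis_a Rot = {(1, 0, -1, -1)}"
| "kind T Axis_a Screw = {(1, T / 2, -1, -1)}"
| "kind T Axis_b Mirror = {(1, 0, -1, 1)}"
| "kind T Axis_b Glide = {(1, T / 2, -1, 1)}"
| "kind T Axis_b Rot = {(-1, t, 1, -1) |t. True}"
| "kind T Axis_c Mirror = {(1, 0, 1, -1)}"
| "kind T Axis_c Glide = {(1, T / 2, 1, -1)}"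
| "kind T Axis_c Rot = {(-1, t, -1, 1) |t. True}"
| "kind T Axis_c Rotoreflection = {(-1, t, -1, -1) |t. True}"
| "kind T _ _ = {}"

definition pure_translations :: "isometry set" where
  "pure_translations = {(1, t, 1, 1) |t. True}"

definition label_kinds :: "real \<Rightarrow> label \<Rightarrow> isometry set" where
  "label_kinds T L = (\<Union>ax. \<Union>\<sigma>\<in>symbols_at L ax. kind T ax \<sigma>)"

text \<open>
  Every symbol of the label must be witnessed by a symmetry. Any two symmetries of the same kind
  differ by a translation in the group, so taking all of them as generators gives the same group
  as choosing one for each symbol.
\<close>

definition has_type :: "(int \<Rightarrow> bool) \<Rightarrow> bool list \<Rightarrow> label \<Rightarrow> bool" where
  "has_type x y L \<longleftrightarrow>
     (\<exists>T>0. symmetries x y \<inter> pure_translations = {(1, T * of_int k, 1, 1) |k::int. True} \<and>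
       (\<forall>ax. \<forall>\<sigma>\<in>symbols_at L ax. symmetries x y \<inter> kind T ax \<sigma> \<noteq> {}) \<and>
       symmetries x y =
         generate isometry_group (symmetries x y \<inter> (pure_translations \<union> label_kinds T L)))"

definition realised_in_hitomezashi :: "label \<Rightarrow> bool" where
  "realised_in_hitomezashi L \<longleftrightarrow>
     (\<exists>x y. periodic_seq x \<and> length y \<ge> 2 \<and> has_type x y L)"

definition two_sided_frieze_types :: "label set" where
  "two_sided_frieze_types =
    {P {} {} {},
     P {Mirror} {} {},
     P {} {} {Rot},
     P {} {Rot} {},
     P {} {} {Rotoreflection},
     P {} {Mirror} {},
     P {Mirror} {Mirror} {Rot},
     P {} {Rot, Mirror} {},
     P {} {Glide} {},
     P {Mirror} {Glide} {Rot},
     P {} {Rot, Glide} {},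
     P {} {} {Mirror},
     P {Mirror} {Rot} {Mirror},
     P {} {} {Rot, Mirror},
     P {} {} {Glide},
     P {Mirror} {Rot} {Glide},
     P {} {} {Rot, Glide},
     P {Rot} {} {},
     P {Rot, Mirror} {} {},
     P {Rot} {Rot} {Rot},
     P {Screw} {} {},
     P {Screw, Mirror} {} {},
     P {Screw} {Rot} {Rot},
     P {Rot} {Mirror} {Mirror},
     P {Mirror} {Mirror} {Mirror},
     P {Screw} {Glide} {Mirror},
     P {Mirror} {Glide} {Mirror},
     P {Screw} {Mirror} {Glide},
     P {Mirror} {Mirror} {Glide},
     P {Rot} {Glide} {Glide},
     P {Mirror} {Glide} {Glide}}"

end

theory Submission
  imports Defs
begin

text \<open>
  A mirror in the second position and a glide in the fourth are incompatible for a parity reason.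

  A symmetry moves grid edges to grid edges, so its shift is an integer. Horizontal stitches and gaps
  alternate along each row, so the parity of that integer is forced by what the symmetry does to
  one row. A reflection \<open>X \<mapsto> k - X\<close> that preserves the front carries the horizontal edge starting
  at \<open>i\<close> to the one starting at \<open>k - i - 1\<close>, hence \<open>k\<close> is odd: the axis passes through the midpoint
  of a horizontal edge. A shift by \<open>m\<close> that exchanges stitches and gaps must have \<open>m\<close> odd as well.

  The vertical edges of the lowest row copy \<open>x\<close>. The mirror therefore gives \<open>x (k - i) = x i\<close>
  (\<open>mirror_symmetry_palindromic\<close>) and the glide \<open>x (i + m) \<noteq> x i\<close>
  (\<open>side_exchanging_shift_antiperiodic\<close>). As \<open>k - m\<close> is even, \<open>i = (k - m) / 2\<close> is an integer, and
  for it \<open>k - i = i + m\<close>, a contradiction.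
\<close>

lemma vedge_eq_iff [simp]: "vedge i j = vedge i' j' \<longleftrightarrow> i = i' \<and> j = j'"
  by (auto simp: vedge_def doubleton_eq_iff)

lemma hedge_eq_iff [simp]: "hedge i j = hedge i' j' \<longleftrightarrow> i = i' \<and> j = j'"
  by (auto simp: hedge_def doubleton_eq_iff)

lemma hedge_neq_vedge [simp]: "hedge i j \<noteq> vedge i' j'" "vedge i' j' \<noteq> hedge i j"
  by (auto simp: hedge_def vedge_def doubleton_eq_iff)

lemma hedge_in_front_stitches_iff:
  assumes "1 \<le> j" "j \<le> length y"
  shows "hedge i j \<in> front_stitches x y \<longleftrightarrow> (y ! (j - 1) \<longleftrightarrow> even i)"
  using assms by (auto simp: front_stitches_def)

lemma vedge_in_front_stitches_iff:
  assumes "1 \<le> j" "j \<le> length y - 1"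
  shows "vedge i j \<in> front_stitches x y \<longleftrightarrow> (x i \<longleftrightarrow> odd j)"
  using assms by (auto simp: front_stitches_def)

lemma front_stitches_subset_grid_edges: "front_stitches x y \<subseteq> grid_edges (length y)"
  unfolding front_stitches_def grid_edges_def by blast

lemma symmetry_maps_grid_edges:
  assumes "g \<in> symmetries x y" "a \<in> grid_edges (length y)"
  shows "planar_action (length y) g ` a \<in> grid_edges (length y)"
proof (cases "a \<in> front_stitches x y")
  case True
  then show ?thesis
    using assms(1) front_stitches_subset_grid_edges[of x y]
    unfolding symmetries_def edge_action_def back_stitches_def
    by (auto split: if_splits)
next
  case False
  with assms(2) have "a \<in> back_stitches x y"
    by (simp add: back_stitches_def)
  then have "planar_action (length y) g ` a \<in> front_stitches x y \<union> back_stitches x y"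
    using assms(1) unfolding symmetries_def edge_action_def
    by (auto split: if_splits)
  then show ?thesis
    using front_stitches_subset_grid_edges[of x y] by (auto simp: back_stitches_def)
qed

lemma symmetry_maps_stitches_iff:
  assumes "g \<in> symmetries x y" "a \<in> grid_edges (length y)"
  shows "planar_action (length y) g ` a \<in> front_stitches x y \<longleftrightarrow>
           (a \<in> front_stitches x y \<longleftrightarrow> \<not> exchanges_sides g)"
  using assms unfolding symmetries_def edge_action_def back_stitches_def
  by (auto split: if_splits)

lemma grid_edge_fst_in_Ints:
  assumes "a \<in> grid_edges n" "(X, Y) \<in> a"
  shows "X \<in> \<int>"
  using assms by (auto simp: grid_edges_def hedge_def vedge_def)

lemma symmetry_shift_in_Ints:
  assumes "(s, t, e, d) \<in> symmetries x y" "length y \<ge> 2"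
  shows "t \<in> \<int>"
proof -
  \<comment> \<open>The shift is the first coordinate of the image of a grid point over 0.\<close>
  have "vedge 0 1 \<in> grid_edges (length y)"
    using assms(2) unfolding grid_edges_def by fastforce
  then have "planar_action (length y) (s, t, e, d) ` vedge 0 1 \<in> grid_edges (length y)"
    by (rule symmetry_maps_grid_edges[OF assms(1)])
  moreover have "(t, if e = 1 then 1 else of_nat (length y) + 1 - 1)
                   \<in> planar_action (length y) (s, t, e, d) ` vedge 0 1"
    by (auto simp: vedge_def)
  ultimately show ?thesis
    by (rule grid_edge_fst_in_Ints)
qed

text \<open>
  Isometries with \<open>e = 1\<close> keep the rows. A reflection exchanges the two ends of a horizontal edge,
  which is why its left end lands at \<open>k - i - 1\<close> rather than \<open>k - i\<close>; this off-by-one makes \<open>k\<close>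
  odd in \<open>mirror_symmetry_palindromic\<close>.
\<close>

lemma shift_image_edges:
  "planar_action n (1, of_int m, 1, d) ` hedge i j = hedge (i + m) j"
  "planar_action n (1, of_int m, 1, d) ` vedge i j = vedge (i + m) j"
  by (simp_all add: hedge_def vedge_def algebra_simps)

lemma reflection_image_edges:
  "planar_action n (-1, of_int k, 1, d) ` hedge i j = hedge (k - i - 1) j"
  "planar_action n (-1, of_int k, 1, d) ` vedge i j = vedge (k - i) j"
  by (auto simp: hedge_def vedge_def algebra_simps)

lemma bottom_edges_in_grid_edges:
  assumes "length y \<ge> 2"
  shows "hedge i 1 \<in> grid_edges (length y)" "vedge i 1 \<in> grid_edges (length y)"
  using assms unfolding grid_edges_def by fastforce+

lemma mirror_symmetry_palindromic:
  assumes sym: "(-1, t, 1, 1) \<in> symmetries x y" and len: "length y \<ge> 2"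
  obtains k where "odd k" "\<And>i. x (k - i) = x i"
proof -
  obtain k where t: "t = of_int k"
    using symmetry_shift_in_Ints[OF sym len] by (elim Ints_cases)
  note moves = symmetry_maps_stitches_iff[OF sym[unfolded t]]
  have "odd k"
    using moves[OF bottom_edges_in_grid_edges(1)[OF len, of 0]] len
    by (auto simp: reflection_image_edges hedge_in_front_stitches_iff)
  moreover have "x (k - i) = x i" for i
    using moves[OF bottom_edges_in_grid_edges(2)[OF len, of i]] len
    by (simp add: reflection_image_edges vedge_in_front_stitches_iff)
  ultimately show thesis
    by (rule that)
qed

lemma side_exchanging_shift_antiperiodic:
  assumes sym: "(1, t, 1, -1) \<in> symmetries x y" and len: "length y \<ge> 2"
  obtains m where "odd m" "\<And>i. x (i + m) \<noteq> x i"
proof -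
  obtain m where t: "t = of_int m"
    using symmetry_shift_in_Ints[OF sym len] by (elim Ints_cases)
  note moves = symmetry_maps_stitches_iff[OF sym[unfolded t]]
  have "odd m"
    using moves[OF bottom_edges_in_grid_edges(1)[OF len, of 0]] len
    by (auto simp: shift_image_edges hedge_in_front_stitches_iff)
  moreover have "x (i + m) \<noteq> x i" for i
    using moves[OF bottom_edges_in_grid_edges(2)[OF len, of i]] len
    by (simp add: shift_image_edges vedge_in_front_stitches_iff)
  ultimately show thesis
    by (rule that)
qed

lemma no_mirror_with_side_exchanging_shift:
  assumes "(-1, t, 1, 1) \<in> symmetries x y" "(1, u, 1, -1) \<in> symmetries x y" "length y \<ge> 2"
  shows False
proof -
  obtain k where k: "odd k" "\<And>i. x (k - i) = x i"
    using mirror_symmetry_palindromic[OF assms(1,3)] by blast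
  obtain m where m: "odd m" "\<And>i. x (i + m) \<noteq> x i"
    using side_exchanging_shift_antiperiodic[OF assms(2,3)] by blast
  from k(1) m(1) have "even (k - m)"
    by simp
  then obtain i where "k - m = 2 * i"
    by (elim evenE)
  then have "k - i = i + m"
    by simp
  with k(2)[of i] m(2)[of i] show False
    by simp
qed

lemma not_realised_if_mirror_and_glide:
  assumes "Mirror \<in> symbols_at L Axis_a" "Glide \<in> symbols_at L Axis_c"
  shows "\<not> realised_in_hitomezashi L"
proof
  assume "realised_in_hitomezashi L"
  then obtain x y T where len: "length y \<ge> 2"
    and wit: "\<forall>ax. \<forall>\<sigma>\<in>symbols_at L ax. symmetries x y \<inter> kind T ax \<sigma> \<noteq> {}"
    unfolding realised_in_hitomezashi_def has_type_def by blast
  have "symmetries x y \<inter> kind T Axis_a Mirror \<noteq> {}"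
    using wit assms(1) by blast
  moreover have "symmetries x y \<inter> kind T Axis_c Glide \<noteq> {}"
    using wit assms(2) by blast
  ultimately show False
    using no_mirror_with_side_exchanging_shift[OF _ _ len] by auto
qed

theorem theorem3:
  "(\<forall>L\<in>two_sided_frieze_types.
      Mirror \<in> symbols_at L Axis_a \<and> Glide \<in> symbols_at L Axis_c \<longrightarrow>
      \<not> realised_in_hitomezashi L) \<and>
   \<not> realised_in_hitomezashi (P {Mirror} {Mirror} {Glide}) \<and>
   \<not> realised_in_hitomezashi (P {Mirror} {Glide} {Glide}) \<and>
   \<not> realised_in_hitomezashi (P {Mirror} {Rot} {Glide})"
  by (intro conjI ballI impI not_realised_if_mirror_and_glide) simp_all

end
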